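(* Let $\kappa\in\mathcal{L}_1$, let $k$ be its associated Sonine kernel, and let $n\in\mathbb{N}$. For a function $f\in C_{-1}^{n}(0,+\infty)$, the formula $$(\mathbb{I}_{(\kappa)}^{<n>}\,{}_*\mathbb{D}_{(k)}^{<n>}\,f)(x)=f(x)-f(0)-\sum_{j=1}^{n-1}\left({}_*\mathbb{D}_{(k)}^{<j>}\,f\right)(0)\,\left(\{1\}*\kappa^{<j>}\right)(x),\quad x>0,$$ holds valid, where $\mathbb{I}_{(\kappa)}^{<n>}$ is the $n$-fold general fractional integral and ${}_*\mathbb{D}_{(k)}^{<n>}$ is the $n$-fold sequential general fractional derivative in the Caputo sense.
   Context: Functions are real-valued functions on $(0,+\infty)$. Convolution: $(f*g)(x)=\int_0^x f(x-\xi)g(\xi)\,d\xi$, $x>0$. Convolution powers: $g^{<1>}=g$ and $g^{<n>}=g*\cdots*g$ ($n$ factors) for $n\ge 2$. $\{1\}$ denotes the function identically equal to $1$. Spaces: $C_{-1}(0,+\infty)=\{f:\ f(x)=x^{q}f_1(x),\ x>0,\ \text{for some } q>-1 \text{ and } f_1\in C[0,+\infty)\}$; $C_{-1}^n(0,+\infty)=\{f:\ f^{(n)}\in C_{-1}(0,+\infty)\}$, $n\in\mathbb{N}$; $C_{-1,0}(0,+\infty)=\{f:\ f(x)=x^{p-1}f_1(x),\ x>0,\ \text{for some } 0<p<1 \text{ and } f_1\in C[0,+\infty)\}$. Sonine kernels: a pair $\kappa,k$ belongs to $\mathcal{L}_1$ if $\kappa,k\in C_{-1,0}(0,+\infty)$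 and $(\kappa*k)(x)=1$ for all $x>0$. The function $k$ is called the Sonine kernel associated to $\kappa$; $\kappa\in\mathcal{L}_1$ means that $\kappa$ belongs to such a pair. Operators: $(\mathbb{I}_{(\kappa)}f)(x)=(\kappa*f)(x)$ and $({}_*\mathbb{D}_{(k)}f)(x)=(k*f')(x)$. $\mathbb{I}_{(\kappa)}^{<n>}$ and ${}_*\mathbb{D}_{(k)}^{<n>}$ are the $n$-fold compositions of $\mathbb{I}_{(\kappa)}$ and ${}_*\mathbb{D}_{(k)}$ with themselves, respectively. For a function $g$ on $(0,+\infty)$, $g(0)$ denotes the value at $0$ of its continuous extension, i.e. $\lim_{x\to0+}g(x)$.
   Formalization: For n ≥ 3 it is also assumed that the n-fold sequential derivative is defined: for 2 ≤ j < n the j-fold derivative of f is differentiable on (0,∞) and its convolution integral with k converges absolutely; this can fail, e.g. f(x)=x, n=3, k=x^{-a}/Γ(1-a), 1/2<a<1. *)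

theory Defs
  imports "HOL-Analysis.Analysis"
begin

text \<open>
  Functions on $(0,+\infty)$ are rendered as functions \<^typ>\<open>real \<Rightarrow> real\<close> of which only the
  values at positive arguments are ever used; since $(0,+\infty)$ is open, this also holds for
  derivatives at positive points.  Integrals are Lebesgue integrals.
\<close>

definition conv :: "(real \<Rightarrow> real) \<Rightarrow> (real \<Rightarrow> real) \<Rightarrow> real \<Rightarrow> real" where
  "conv f g x = (LBINT \<xi>:{0<..<x}. f (x - \<xi>) * g \<xi>)"

definition conv_exists :: "(real \<Rightarrow> real) \<Rightarrow> (real \<Rightarrow> real) \<Rightarrow> bool" where
  "conv_exists f g \<longleftrightarrow> (\<forall>x>0. set_integrable lborel {0<..<x} (\<lambda>\<xi>. f (x - \<xi>) * g \<xi>))"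

text \<open>Meaningful for \<open>n \<ge> 1\<close> only: \<open>n\<close> counts the factors.\<close>

definition conv_pow :: "(real \<Rightarrow> real) \<Rightarrow> nat \<Rightarrow> real \<Rightarrow> real" where
  "conv_pow g n = (conv g ^^ (n - 1)) g"

definition C_minus1 :: "(real \<Rightarrow> real) set" where
  "C_minus1 = {f. \<exists>q f1. q > -1 \<and> continuous_on {0..} f1 \<and> (\<forall>x>0. f x = x powr q * f1 x)}"

definition C_minus1_n :: "nat \<Rightarrow> (real \<Rightarrow> real) set" where
  "C_minus1_n n = {f. (\<forall>m<n. \<forall>x>0. (deriv ^^ m) f differentiable (at x))
                      \<and> (deriv ^^ n) f \<in> C_minus1}"

definition C_minus1_0 :: "(real \<Rightarrow> real) set" where
  "C_minus1_0 = {f. \<exists>p f1. 0 < p \<and> p < 1 \<and> continuous_on {0..} f1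
                      \<and> (\<forall>x>0. f x = x powr (p - 1) * f1 x)}"

definition sonine_L1 :: "((real \<Rightarrow> real) \<times> (real \<Rightarrow> real)) set" where
  "sonine_L1 = {(\<kappa>, k). \<kappa> \<in> C_minus1_0 \<and> k \<in> C_minus1_0 \<and> (\<forall>x>0. conv \<kappa> k x = 1)}"

definition gfi :: "(real \<Rightarrow> real) \<Rightarrow> (real \<Rightarrow> real) \<Rightarrow> real \<Rightarrow> real" where
  "gfi \<kappa> f = conv \<kappa> f"

definition caputo_gfd :: "(real \<Rightarrow> real) \<Rightarrow> (real \<Rightarrow> real) \<Rightarrow> real \<Rightarrow> real" where
  "caputo_gfd k f = conv k (deriv f)"

text \<open>
  Both \<^const>\<open>deriv\<close> and the Lebesgue integral are total in HOL.  The next predicate says that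
  \<open>caputo_gfd k f\<close> is defined on all of $(0,+\infty)$ in the usual sense.
\<close>

definition caputo_gfd_exists :: "(real \<Rightarrow> real) \<Rightarrow> (real \<Rightarrow> real) \<Rightarrow> bool" where
  "caputo_gfd_exists k f \<longleftrightarrow> (\<forall>x>0. f differentiable (at x)) \<and> conv_exists k (deriv f)"

text \<open>
  Existence of the \<open>n\<close>-fold sequential derivative of a function in \<open>C_minus1_n n\<close>.  The
  applications of \<open>caputo_gfd k\<close> number \<open>0\<close> and \<open>1\<close> are always possible for such functions, so
  nothing is required of them and the predicate is trivially true for \<open>n \<le> 2\<close>.  From the third
  application on this can fail: for \<open>f x = x\<close> and
  $k(x) = x^{-\alpha}/\Gamma(1-\alpha)$ with $1/2 < \alpha < 1$ the second derivative is
  $x^{1-2\alpha}/\Gamma(2-2\alpha)$, which has no value at \<open>0\<close>, and the third one is a divergent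
  integral.
\<close>

definition seq_caputo_gfd_exists :: "(real \<Rightarrow> real) \<Rightarrow> nat \<Rightarrow> (real \<Rightarrow> real) \<Rightarrow> bool" where
  "seq_caputo_gfd_exists k n f \<longleftrightarrow> (\<forall>j\<in>{2..<n}. caputo_gfd_exists k ((caputo_gfd k ^^ j) f))"

definition val0 :: "(real \<Rightarrow> real) \<Rightarrow> real" where
  "val0 g = Lim (at_right 0) g"

end

theory Submission
  imports Defs
begin

text \<open>
  For \<open>g\<close> differentiable on $(0,+\infty)$ with \<open>g'\<close> integrable near \<open>0\<close>, associativity of the
  convolution and \<open>\<kappa> * k = 1\<close> give \<open>\<kappa> * (k * g') = 1 * g' = g - g(0)\<close>; the theorem follows by
  induction on \<open>n\<close>, with \<open>g\<close> the \<open>n\<close>-th sequential derivative of \<open>f\<close>, since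
  $\kappa * (\cdots * (\kappa * 1)) = 1 * \kappa^{<n>}$.

  For the second and later derivatives, \<open>g'\<close> need not be continuous or locally bounded.  That
  \<open>k * g'\<close> exists still makes \<open>g'\<close> locally integrable, because \<open>k\<close> is bounded away from \<open>0\<close> on some
  interval.  Associativity is then available only almost everywhere; this suffices because at least
  one more convolution with \<open>\<kappa>\<close> is applied to the result.
\<close>

section \<open>Convolution of locally integrable functions\<close>

text \<open>Extension by zero turns a convolution over \<open>{0<..<x}\<close> into an integral over
  the whole line, so that translations, reflections and Fubini need no bookkeeping of
  domains.\<close>

definition zext :: "(real \<Rightarrow> real) \<Rightarrow> real \<Rightarrow> real" where
  "zext f x = indicator {0<..} x * f x"

text \<open>Local integrability on the half-line closed at 0: a singularity at 0 is allowed, but it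
  must be integrable.\<close>

definition loc_int :: "(real \<Rightarrow> real) \<Rightarrow> bool" where
  "loc_int f \<longleftrightarrow> (\<forall>X. set_integrable lborel {0<..<X} f)"

definition cont_loc_int :: "(real \<Rightarrow> real) \<Rightarrow> bool" where
  "cont_loc_int f \<longleftrightarrow> continuous_on {0<..} f \<and> loc_int f"

text \<open>With values in \<open>ennreal\<close> the convolution is meaningful at every point;
  applied to absolute values, its finiteness at \<open>x\<close> expresses absolute convergence at
  \<open>x\<close>.\<close>

definition nconv :: "(real \<Rightarrow> ennreal) \<Rightarrow> (real \<Rightarrow> ennreal) \<Rightarrow> real \<Rightarrow> ennreal" where
  "nconv F G x = (\<integral>\<^sup>+t. F (x - t) * G t \<partial>lborel)"

lemma zext_pos [simp]: "x > 0 \<Longrightarrow> zext f x = f x"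
  and zext_nonpos [simp]: "x \<le> 0 \<Longrightarrow> zext f x = 0"
  by (auto simp: zext_def)

lemma zext_cong: "(\<And>x. x > 0 \<Longrightarrow> f x = g x) \<Longrightarrow> zext f = zext g"
  by (auto simp: zext_def fun_eq_iff indicator_def)

lemma indicator_zext:
  "indicator {0<..<X} t *\<^sub>R f t = indicator {..<X} t * zext f t"
  by (auto simp: indicator_def zext_def)

lemma conv_zext: "conv f g x = (\<integral>t. zext f (x - t) * zext g t \<partial>lborel)"
  unfolding conv_def set_lebesgue_integral_def
  by (intro Bochner_Integration.integral_cong) (auto simp: zext_def indicator_def)

lemma zext_mult_nonpos: "x \<le> 0 \<Longrightarrow> zext f (x - t) * zext g t = 0"
  by (cases "t > 0") auto

lemma conv_nonpos [simp]: "x \<le> 0 \<Longrightarrow> conv f g x = 0"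
  by (simp add: conv_zext zext_mult_nonpos)

lemma zext_conv [simp]: "zext (conv f g) = conv f g"
  by (auto simp: zext_def fun_eq_iff indicator_def)

lemma conv_cong:
  assumes "\<And>t. t > 0 \<Longrightarrow> f t = f' t" "\<And>t. t > 0 \<Longrightarrow> g t = g' t"
  shows "conv f g = conv f' g'"
  using zext_cong[of f f'] zext_cong[of g g'] assms by (auto simp: conv_zext fun_eq_iff)

lemma conv_commute: "conv f g = conv g f"
proof
  fix x
  show "conv f g x = conv g f x"
    unfolding conv_zext
    by (subst lborel_integral_real_affine[where c = "-1" and t = x]) (auto simp: algebra_simps)
qed

text \<open>A convolution does not see null sets, so an identity known almost everywhere becomes an
  identity at every point after one more convolution.\<close>

lemma conv_cong_AE:
  assumes "AE t in lborel. t > 0 \<longrightarrow> g t = g' t"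
    and [measurable]: "zext f \<in> borel_measurable borel" "zext g \<in> borel_measurable borel"
      "zext g' \<in> borel_measurable borel"
  shows "conv f g = conv f g'"
proof
  fix x
  show "conv f g x = conv f g' x"
    unfolding conv_zext
  proof (rule integral_cong_AE)
    show "AE t in lborel. zext f (x - t) * zext g t = zext f (x - t) * zext g' t"
      using assms(1) by eventually_elim (auto simp: zext_def indicator_def)
  qed simp_all
qed

lemma loc_int_D:
  assumes "loc_int f"
  shows "integrable lborel (\<lambda>t. indicator {..<X} t * zext f t)"
  using assms unfolding loc_int_def set_integrable_def indicator_zext by blast

text \<open>The truncations to \<open>{..<real n}\<close> are measurable and, at each point,
  eventually equal to \<open>zext f\<close>.\<close>

lemma loc_int_measurable [measurable_dest]:
  assumes "loc_int f"
  shows "zext f \<in> borel_measurable borel"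
proof (rule borel_measurable_LIMSEQ_real)
  fix x :: real
  obtain N :: nat where "x < N" using reals_Archimedean2 by blast
  then have "\<forall>n\<ge>N. indicator {..<real n} x * zext f x = zext f x"
    by (auto simp: indicator_def)
  then show "(\<lambda>n. indicator {..<real n} x * zext f x) \<longlonglongrightarrow> zext f x"
    by (intro tendsto_eventually eventually_sequentiallyI[of N]) auto
next
  fix n :: nat
  show "(\<lambda>x. indicator {..<real n} x * zext f x) \<in> borel_measurable borel"
    using loc_int_D[OF assms, of "real n"] by (auto dest: borel_measurable_integrable)
qed

lemma loc_intI:
  assumes [measurable]: "zext f \<in> borel_measurable borel"
    and "\<And>X. (\<integral>\<^sup>+t. indicator {..<X} t * ennreal \<bar>zext f t\<bar> \<partial>lborel) < \<infinity>"
  shows "loc_int f"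
  unfolding loc_int_def set_integrable_def indicator_zext
proof
  fix X
  have "(\<integral>\<^sup>+t. norm (indicator {..<X} t * zext f t) \<partial>lborel)
      = (\<integral>\<^sup>+t. indicator {..<X} t * ennreal \<bar>zext f t\<bar> \<partial>lborel)"
    by (intro nn_integral_cong) (auto simp: indicator_def)
  with assms(2)[of X] show "integrable lborel (\<lambda>t. indicator {..<X} t * zext f t)"
    by (auto simp: integrable_iff_bounded)
qed

section \<open>Local integrability of nonnegative convolutions\<close>

definition nloc_int :: "(real \<Rightarrow> ennreal) \<Rightarrow> bool" where
  "nloc_int F \<longleftrightarrow> F \<in> borel_measurable borel \<and> (\<forall>x\<le>0. F x = 0) \<and>
     (\<forall>X. (\<integral>\<^sup>+x. indicator {..<X} x * F x \<partial>lborel) < \<infinity>)"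

lemma nloc_int_abs:
  assumes "loc_int f"
  shows "nloc_int (\<lambda>t. ennreal \<bar>zext f t\<bar>)"
proof -
  have [measurable]: "zext f \<in> borel_measurable borel" using assms by (rule loc_int_measurable)
  have "(\<integral>\<^sup>+t. indicator {..<X} t * ennreal \<bar>zext f t\<bar> \<partial>lborel) < \<infinity>" for X
  proof -
    have "(\<integral>\<^sup>+t. indicator {..<X} t * ennreal \<bar>zext f t\<bar> \<partial>lborel)
        = (\<integral>\<^sup>+t. norm (indicator {..<X} t * zext f t) \<partial>lborel)"
      by (intro nn_integral_cong) (auto simp: indicator_def)
    also have "\<dots> < \<infinity>"
      using loc_int_D[OF assms, of X] by (auto simp: integrable_iff_bounded)
    finally show ?thesis .
  qed
  then show ?thesis by (auto simp: nloc_int_def)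
qed

lemma nconv_measurable [measurable]:
  assumes [measurable]: "F \<in> borel_measurable borel" "G \<in> borel_measurable borel"
  shows "nconv F G \<in> borel_measurable borel"
  unfolding nconv_def by measurable

text \<open>Young's inequality for L1, localised to \<open>{..<X}\<close>: by Tonelli the integral
  of the convolution is at most the product of the two integrals.\<close>

lemma nloc_int_nconv:
  assumes "nloc_int F" "nloc_int G"
  shows "nloc_int (nconv F G)"
proof -
  have [measurable]: "F \<in> borel_measurable borel" "G \<in> borel_measurable borel"
    using assms by (auto simp: nloc_int_def)
  have F0: "F x = 0" and G0: "G x = 0" if "x \<le> 0" for x
    using assms that by (auto simp: nloc_int_def)
  have "nconv F G x = 0" if "x \<le> 0" for x
  proof -
    have "F (x - t) * G t = 0" for t
      using F0[of "x - t"] G0[of t] that by (cases "t > 0") auto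
    then show ?thesis by (simp add: nconv_def del: mult_eq_0_iff)
  qed
  moreover have "(\<integral>\<^sup>+x. indicator {..<X} x * nconv F G x \<partial>lborel) < \<infinity>" for X
  proof -
    let ?i = "indicator {..<X} :: real \<Rightarrow> ennreal"
    have "(\<integral>\<^sup>+x. ?i x * nconv F G x \<partial>lborel)
        = (\<integral>\<^sup>+x. \<integral>\<^sup>+t. ?i x * (F (x - t) * G t) \<partial>lborel \<partial>lborel)"
      by (simp add: nconv_def nn_integral_cmult)
    \<comment> \<open>Where the integrand is nonzero, both \<open>t\<close> and \<open>x - t\<close>
      are positive; as they add up to \<open>x < X\<close>, each of them is below
      \<open>X\<close>.\<close>
    also have "\<dots> \<le> (\<integral>\<^sup>+x. \<integral>\<^sup>+t. (?i (x - t) * F (x - t)) * (?i t * G t) \<partial>lborel \<partial>lborel)"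
    proof (intro nn_integral_mono)
      fix x t :: real
      show "?i x * (F (x - t) * G t) \<le> (?i (x - t) * F (x - t)) * (?i t * G t)"
        using F0[of "x - t"] G0[of t]
        by (cases "t > 0"; cases "x - t > 0"; auto simp: indicator_def)
    qed
    also have "\<dots> = (\<integral>\<^sup>+t. \<integral>\<^sup>+x. (?i (x - t) * F (x - t)) * (?i t * G t) \<partial>lborel \<partial>lborel)"
      by (rule lborel_pair.Fubini'[symmetric]) simp
    also have "\<dots> = (\<integral>\<^sup>+t. (\<integral>\<^sup>+x. ?i (x - t) * F (x - t) \<partial>lborel) * (?i t * G t) \<partial>lborel)"
      by (simp add: nn_integral_multc)
    also have "\<dots> = (\<integral>\<^sup>+t. (\<integral>\<^sup>+x. ?i x * F x \<partial>lborel) * (?i t * G t) \<partial>lborel)"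
    proof -
      have "(\<integral>\<^sup>+x. ?i (x - t) * F (x - t) \<partial>lborel) = (\<integral>\<^sup>+x. ?i x * F x \<partial>lborel)" for t
        by (subst (2) nn_integral_real_affine[where c = 1 and t = "-t"]) auto
      then show ?thesis by simp
    qed
    also have "\<dots> = (\<integral>\<^sup>+x. ?i x * F x \<partial>lborel) * (\<integral>\<^sup>+t. ?i t * G t \<partial>lborel)"
      by (simp add: nn_integral_cmult)
    also have "\<dots> < \<infinity>"
      using assms by (simp add: nloc_int_def ennreal_mult_less_top)
    finally show ?thesis .
  qed
  ultimately show ?thesis by (auto simp: nloc_int_def)
qed

text \<open>A finite integral over each \<open>{..<real n}\<close> excludes the value infinity there
  up to a null set, and countably many null sets are discarded.\<close>

lemma nloc_int_AE_finite:
  assumes "nloc_int F"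
  shows "AE x in lborel. F x < \<infinity>"
proof -
  have [measurable]: "F \<in> borel_measurable borel" using assms by (auto simp: nloc_int_def)
  have "AE x in lborel. \<forall>n::nat. indicator {..<real n} x * F x \<noteq> \<infinity>"
    unfolding AE_all_countable
  proof
    fix n :: nat
    show "AE x in lborel. indicator {..<real n} x * F x \<noteq> \<infinity>"
    proof (rule nn_integral_PInf_AE)
      have "(\<integral>\<^sup>+x. indicator {..<real n} x * F x \<partial>lborel) < \<infinity>"
        using assms by (auto simp: nloc_int_def)
      then show "(\<integral>\<^sup>+x. indicator {..<real n} x * F x \<partial>lborel) \<noteq> \<infinity>" by auto
    qed simp
  qed
  then show ?thesis
  proof eventually_elim
    case (elim x)
    obtain n :: nat where "x < n" using reals_Archimedean2 by blast
    with elim[rule_format, of n] show ?case by (auto simp: less_top)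
  qed
qed

section \<open>Real-valued convolution: domination and associativity\<close>

lemma conv_measurable [measurable]:
  assumes [measurable]: "zext f \<in> borel_measurable borel" "zext g \<in> borel_measurable borel"
  shows "conv f g \<in> borel_measurable borel"
proof -
  have "conv f g = (\<lambda>x. \<integral>t. zext f (x - t) * zext g t \<partial>lborel)" by (auto simp: conv_zext)
  then show ?thesis by simp
qed

lemma abs_conv_le_nconv:
  assumes [measurable]: "zext f \<in> borel_measurable borel" "zext g \<in> borel_measurable borel"
  shows "ennreal \<bar>conv f g x\<bar> \<le> nconv (\<lambda>t. ennreal \<bar>zext f t\<bar>) (\<lambda>t. ennreal \<bar>zext g t\<bar>) x"
proof (cases "integrable lborel (\<lambda>t. zext f (x - t) * zext g t)")
  case True
  have "ennreal \<bar>conv f g x\<bar> \<le> (\<integral>\<^sup>+t. norm (zext f (x - t) * zext g t) \<partial>lborel)"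
    unfolding conv_zext using integral_norm_bound_ennreal[OF True] by simp
  then show ?thesis by (simp add: nconv_def abs_mult ennreal_mult)
next
  case False
  \<comment> \<open>A divergent Bochner integral has the default value 0, so the bound
    persists.\<close>
  then show ?thesis by (simp add: conv_zext not_integrable_integral_eq)
qed

lemma loc_int_conv:
  assumes "loc_int f" "loc_int g"
  shows "loc_int (conv f g)"
proof (rule loc_intI)
  have [measurable]: "zext f \<in> borel_measurable borel" "zext g \<in> borel_measurable borel"
    using assms by (auto dest: loc_int_measurable)
  show "zext (conv f g) \<in> borel_measurable borel" by simp
  fix X
  let ?F = "nconv (\<lambda>t. ennreal \<bar>zext f t\<bar>) (\<lambda>t. ennreal \<bar>zext g t\<bar>)"
  have "(\<integral>\<^sup>+t. indicator {..<X} t * ennreal \<bar>zext (conv f g) t\<bar> \<partial>lborel)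
      \<le> (\<integral>\<^sup>+t. indicator {..<X} t * ?F t \<partial>lborel)"
    by (intro nn_integral_mono mult_left_mono) (auto intro: abs_conv_le_nconv)
  also have "\<dots> < \<infinity>"
    using nloc_int_nconv[OF nloc_int_abs[OF assms(1)] nloc_int_abs[OF assms(2)]]
    by (auto simp: nloc_int_def)
  finally show "(\<integral>\<^sup>+t. indicator {..<X} t * ennreal \<bar>zext (conv f g) t\<bar> \<partial>lborel) < \<infinity>" .
qed

text \<open>Fubini at a single point: \<open>fin\<close> says precisely that the double integrand is
  absolutely integrable.\<close>

lemma conv_assoc_at:
  assumes [measurable]: "zext f \<in> borel_measurable borel" "zext g \<in> borel_measurable borel"
      "zext h \<in> borel_measurable borel"
    and fin: "nconv (\<lambda>t. ennreal \<bar>zext f t\<bar>)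
        (nconv (\<lambda>t. ennreal \<bar>zext g t\<bar>) (\<lambda>t. ennreal \<bar>zext h t\<bar>)) x < \<infinity>"
  shows "conv f (conv g h) x = conv (conv f g) h x"
proof -
  define P where "P s t = zext f (x - s) * (zext g (s - t) * zext h t)" for s t
  have [measurable]: "case_prod P \<in> borel_measurable (borel \<Otimes>\<^sub>M borel)"
    unfolding P_def by measurable
  have "(\<integral>\<^sup>+p. norm (case_prod P p) \<partial>(lborel \<Otimes>\<^sub>M lborel))
      = (\<integral>\<^sup>+s. \<integral>\<^sup>+t. norm (P s t) \<partial>lborel \<partial>lborel)"
    by (subst lborel.nn_integral_fst[symmetric]) auto
  also have "\<dots> = nconv (\<lambda>t. ennreal \<bar>zext f t\<bar>)
        (nconv (\<lambda>t. ennreal \<bar>zext g t\<bar>) (\<lambda>t. ennreal \<bar>zext h t\<bar>)) x"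
    by (simp add: nconv_def P_def abs_mult ennreal_mult nn_integral_cmult)
  finally have "integrable (lborel \<Otimes>\<^sub>M lborel) (case_prod P)"
    using fin by (auto simp: integrable_iff_bounded)
  from lborel_pair.Fubini_integral[OF this]
  have "(\<integral>t. (\<integral>s. P s t \<partial>lborel) \<partial>lborel) = (\<integral>s. (\<integral>t. P s t \<partial>lborel) \<partial>lborel)" .
  \<comment> \<open>Constant factors can be pulled out even of a divergent integral, whose value is
    0 by default; hence the inner integrals are identified for every \<open>s\<close> and every
    \<open>t\<close>.\<close>
  moreover have "(\<integral>t. P s t \<partial>lborel) = zext f (x - s) * zext (conv g h) s" for s
    by (simp add: P_def conv_zext)
  moreover have "(\<integral>s. P s t \<partial>lborel) = zext (conv f g) (x - t) * zext h t" for t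
  proof -
    have "(\<integral>s. P s t \<partial>lborel) = (\<integral>s. zext f (x - s) * zext g (s - t) \<partial>lborel) * zext h t"
      by (simp add: P_def mult.assoc[symmetric])
    also have "(\<integral>s. zext f (x - s) * zext g (s - t) \<partial>lborel)
        = (\<integral>s. zext f (x - t - s) * zext g s \<partial>lborel)"
      by (subst lborel_integral_real_affine[where c = 1 and t = t]) (auto simp: algebra_simps)
    finally show ?thesis by (simp add: conv_zext)
  qed
  ultimately show ?thesis by (simp add: conv_zext[of f] conv_zext[of _ h])
qed

text \<open>The threefold convolution of the absolute values is locally integrable, hence finite
  almost everywhere.\<close>

lemma conv_assoc_AE:
  assumes "loc_int f" "loc_int g" "loc_int h"
  shows "AE x in lborel. conv f (conv g h) x = conv (conv f g) h x"
  using nloc_int_AE_finite[OF nloc_int_nconv[OF nloc_int_abs[OF assms(1)]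
      nloc_int_nconv[OF nloc_int_abs[OF assms(2)] nloc_int_abs[OF assms(3)]]]]
  by eventually_elim (rule conv_assoc_at, use assms in \<open>auto dest: loc_int_measurable\<close>)

section \<open>Convolution of continuous locally integrable functions\<close>

lemma cont_loc_intD: "cont_loc_int f \<Longrightarrow> continuous_on {0<..} f" "cont_loc_int f \<Longrightarrow> loc_int f"
  by (auto simp: cont_loc_int_def)

lemma cont_loc_int_abs: "cont_loc_int f \<Longrightarrow> cont_loc_int (\<lambda>t. \<bar>f t\<bar>)"
  by (auto simp: cont_loc_int_def loc_int_def intro: continuous_intros set_integrable_abs)

lemma zext_abs: "zext (\<lambda>t. \<bar>f t\<bar>) t = \<bar>zext f t\<bar>"
  by (simp add: zext_def abs_mult)

text \<open>
  With the two halves of the convolution integral, each factor is evaluated away from its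
  singularity at \<open>0\<close> in one of them.
\<close>

definition conv_half :: "(real \<Rightarrow> real) \<Rightarrow> (real \<Rightarrow> real) \<Rightarrow> real \<Rightarrow> real \<Rightarrow> real" where
  "conv_half f g x t = indicator {..<x / 2} t * (zext f (x - t) * zext g t)"

text \<open>For \<open>a < x < 2 * a\<close> and \<open>0 < t < x / 2\<close> the argument
  \<open>x - t\<close> stays in the compact set \<open>{a / 2..2 * a}\<close>, where
  \<open>f\<close> is bounded. As \<open>M\<close> does not depend on \<open>x\<close>, the bound
  serves as a majorant for dominated convergence.\<close>

lemma conv_half_bound:
  assumes f: "cont_loc_int f" and "0 < a"
  obtains M where "\<And>x t g. x \<in> {a<..<2 * a} \<Longrightarrow>
      \<bar>conv_half f g x t\<bar> \<le> M * \<bar>indicator {..<2 * a} t * zext g t\<bar>"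
proof -
  have "bounded (f ` {a / 2..2 * a})"
    by (intro compact_imp_bounded compact_continuous_image
          continuous_on_subset[OF cont_loc_intD(1)[OF f]]) (use \<open>0 < a\<close> in auto)
  then obtain M where M: "\<And>y. y \<in> {a / 2..2 * a} \<Longrightarrow> \<bar>f y\<bar> \<le> M"
    by (force simp: bounded_iff)
  have "M \<ge> 0" using M[of a] \<open>0 < a\<close> by auto
  have "\<bar>conv_half f g x t\<bar> \<le> M * \<bar>indicator {..<2 * a} t * zext g t\<bar>"
    if x: "x \<in> {a<..<2 * a}" for x t g
  proof (cases "0 < t \<and> t < x / 2")
    case True
    then have "\<bar>f (x - t)\<bar> * \<bar>g t\<bar> \<le> M * \<bar>g t\<bar>"
      using x by (intro mult_right_mono M) auto
    with True x show ?thesis by (auto simp: conv_half_def abs_mult)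
  next
    case False
    then have "conv_half f g x t = 0" by (auto simp: conv_half_def)
    with \<open>M \<ge> 0\<close> show ?thesis by simp
  qed
  then show ?thesis using that by blast
qed

lemma conv_half_measurable [measurable]:
  assumes [measurable]: "zext f \<in> borel_measurable borel" "zext g \<in> borel_measurable borel"
  shows "conv_half f g x \<in> borel_measurable borel"
  unfolding conv_half_def by measurable

lemma conv_half_integrable:
  assumes f: "cont_loc_int f" and g: "loc_int g" and "0 < x"
  shows "integrable lborel (conv_half f g x)"
proof -
  have [measurable]: "zext f \<in> borel_measurable borel" "zext g \<in> borel_measurable borel"
    using f g by (auto dest: cont_loc_intD loc_int_measurable)
  \<comment> \<open>This choice makes \<open>x\<close> the midpoint of
    \<open>{a<..<2 * a}\<close>.\<close>
  define a where "a = 2 * x / 3"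
  have a: "0 < a" "x \<in> {a<..<2 * a}" using \<open>0 < x\<close> by (auto simp: a_def)
  obtain M where M: "\<And>x t g. x \<in> {a<..<2 * a} \<Longrightarrow>
      \<bar>conv_half f g x t\<bar> \<le> M * \<bar>indicator {..<2 * a} t * zext g t\<bar>"
    using conv_half_bound[OF f a(1)] by blast
  have "integrable lborel (\<lambda>t. M * \<bar>indicator {..<2 * a} t * zext g t\<bar>)"
    by (intro integrable_mult_right integrable_abs loc_int_D g)
  then show ?thesis
  proof (rule Bochner_Integration.integrable_bound)
    show "AE t in lborel. norm (conv_half f g x t) \<le> norm (M * \<bar>indicator {..<2 * a} t * zext g t\<bar>)"
    proof (intro AE_I2)
      fix t
      show "norm (conv_half f g x t) \<le> norm (M * \<bar>indicator {..<2 * a} t * zext g t\<bar>)"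
        using M[OF a(2), of g t] abs_ge_self[of "M * \<bar>indicator {..<2 * a} t * zext g t\<bar>"]
        unfolding real_norm_def by (rule order.trans)
    qed
  qed simp
qed

text \<open>Dominated convergence on each interval \<open>{a<..<2 * a}\<close>; these intervals
  cover the positive half-line.\<close>

lemma conv_half_continuous:
  assumes f: "cont_loc_int f" and g: "loc_int g"
  shows "continuous_on {0<..} (\<lambda>x. integral\<^sup>L lborel (conv_half f g x))"
proof -
  have [measurable]: "zext f \<in> borel_measurable borel" "zext g \<in> borel_measurable borel"
    using f g by (auto dest: cont_loc_intD loc_int_measurable)
  have *: "continuous_on {a<..<2 * a} (\<lambda>x. integral\<^sup>L lborel (conv_half f g x))" if a: "0 < a" for a
    unfolding continuous_on_sequentially o_def
  proof (intro allI ballI impI, elim conjE)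
    fix u y assume y: "y \<in> {a<..<2 * a}" and u: "\<forall>n. u n \<in> {a<..<2 * a}" and lim: "u \<longlonglongrightarrow> y"
    obtain M where M: "\<And>x t g. x \<in> {a<..<2 * a} \<Longrightarrow>
        \<bar>conv_half f g x t\<bar> \<le> M * \<bar>indicator {..<2 * a} t * zext g t\<bar>"
      using conv_half_bound[OF f a(1)] by blast
    show "(\<lambda>n. integral\<^sup>L lborel (conv_half f g (u n))) \<longlonglongrightarrow> integral\<^sup>L lborel (conv_half f g y)"
    proof (rule integral_dominated_convergence)
      show "integrable lborel (\<lambda>t. M * \<bar>indicator {..<2 * a} t * zext g t\<bar>)"
        by (intro integrable_mult_right integrable_abs loc_int_D g)
      show "AE t in lborel. norm (conv_half f g (u n) t) \<le> M * \<bar>indicator {..<2 * a} t * zext g t\<bar>" for n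
        using M u by auto
      show "AE t in lborel. (\<lambda>n. conv_half f g (u n) t) \<longlonglongrightarrow> conv_half f g y t"
        \<comment> \<open>The cut-off at \<open>x / 2\<close> moves with \<open>x\<close>; in the
          limit it can spoil pointwise convergence only at \<open>t = y / 2\<close>.\<close>
        using AE_lborel_singleton[of "y / 2"]
      proof eventually_elim
        case (elim t)
        show ?case
        proof (cases "t < y / 2")
          case True
          then have "\<forall>\<^sub>F n in sequentially. 2 * t < u n"
            using lim by (intro order_tendstoD(1)[of _ y]) auto
          then have "\<forall>\<^sub>F n in sequentially. zext f (u n - t) * zext g t = conv_half f g (u n) t"
            by eventually_elim (auto simp: conv_half_def)
          moreover have "(\<lambda>n. zext f (u n - t) * zext g t) \<longlonglongrightarrow> zext f (y - t) * zext g t"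
          proof (cases "t > 0")
            case t: True
            have "continuous_on {0<..} (zext f)"
              using cont_loc_intD(1)[OF f] by (rule continuous_on_eq) auto
            then have "isCont (zext f) (y - t)"
              using True y t a by (subst (asm) continuous_on_eq_continuous_at) auto
            then have "(\<lambda>n. zext f (u n - t)) \<longlonglongrightarrow> zext f (y - t)"
              by (rule isCont_tendsto_compose) (intro tendsto_intros lim)
            then show ?thesis by (intro tendsto_intros)
          qed auto
          ultimately have "(\<lambda>n. conv_half f g (u n) t) \<longlonglongrightarrow> zext f (y - t) * zext g t"
            by (rule Lim_transform_eventually[rotated])
          then show ?thesis using True by (simp add: conv_half_def)
        next
          case False
          with elim have "2 * t > y" by auto
          then have "\<forall>\<^sub>F n in sequentially. u n < 2 * t"
            using lim by (intro order_tendstoD(2)[of _ y]) auto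
          then have "\<forall>\<^sub>F n in sequentially. conv_half f g (u n) t = conv_half f g y t"
            by eventually_elim (use \<open>2 * t > y\<close> in \<open>auto simp: conv_half_def\<close>)
          then show ?thesis by (rule tendsto_eventually)
        qed
      qed
    qed simp_all
  qed
  have **: "isCont (\<lambda>x. integral\<^sup>L lborel (conv_half f g x)) x" if "0 < a" "a < x" "x < 2 * a" for a x

  proof -
    have "x \<in> {a<..<2 * a}" using that by simp
    then show ?thesis
      using *[OF \<open>0 < a\<close>] by (simp only: continuous_on_eq_continuous_at[OF open_greaterThanLessThan])
  qed
  show ?thesis
  proof (subst continuous_on_eq_continuous_at, simp, intro ballI)
    fix x :: real assume "x \<in> {0<..}"
    then show "isCont (\<lambda>x. integral\<^sup>L lborel (conv_half f g x)) x"
      by (intro **[of "2 * x / 3"]) auto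
  qed
qed

text \<open>The reflection of \<open>t\<close> to \<open>x - t\<close> exchanges the factors and
  carries the part of the integral over \<open>t > x / 2\<close> into
  \<open>conv_half g f x\<close>.\<close>

lemma conv_half_split:
  assumes f: "cont_loc_int f" and g: "cont_loc_int g" and "0 < x"
  shows "has_bochner_integral lborel (\<lambda>t. zext f (x - t) * zext g t)
    (integral\<^sup>L lborel (conv_half f g x) + integral\<^sup>L lborel (conv_half g f x))"
proof -
  have [measurable]: "zext f \<in> borel_measurable borel" "zext g \<in> borel_measurable borel"
    using f g by (auto dest: cont_loc_intD loc_int_measurable)
  have 1: "has_bochner_integral lborel (conv_half f g x) (integral\<^sup>L lborel (conv_half f g x))"
    using assms by (intro has_bochner_integral_integrable conv_half_integrable cont_loc_intD)
  have int: "integrable lborel (conv_half g f x)"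
    using assms by (intro conv_half_integrable cont_loc_intD)
  have 2: "has_bochner_integral lborel (\<lambda>t. conv_half g f x (x + (-1) * t)) (integral\<^sup>L lborel (conv_half g f x))"
    unfolding has_bochner_integral_iff
    using lborel_integrable_real_affine[OF int, of "-1" x]
      lborel_integral_real_affine[of "-1" "conv_half g f x" x] by simp
  have "AE t in lborel. conv_half f g x t + conv_half g f x (x + (-1) * t) = zext f (x - t) * zext g t"
    \<comment> \<open>The two strict halves miss only the midpoint.\<close>
    using AE_lborel_singleton[of "x / 2"]
    by eventually_elim (auto simp: conv_half_def indicator_def)
  then show ?thesis
    using has_bochner_integral_add[OF 1 2] by (subst has_bochner_integral_cong_AE[symmetric]) simp_all
qed

lemma cont_loc_int_integrable:
  assumes "cont_loc_int f" "cont_loc_int g"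
  shows "integrable lborel (\<lambda>t. zext f (x - t) * zext g t)"
proof (cases "0 < x")
  case True
  with conv_half_split[OF assms True] show ?thesis by (auto simp: has_bochner_integral_iff)
next
  case False
  then show ?thesis by (simp add: zext_mult_nonpos)
qed

lemma cont_loc_int_conv:
  assumes "cont_loc_int f" "cont_loc_int g"
  shows "cont_loc_int (conv f g)"
  unfolding cont_loc_int_def
proof
  have "continuous_on {0<..} (\<lambda>x. integral\<^sup>L lborel (conv_half f g x) + integral\<^sup>L lborel (conv_half g f x))"
    using assms by (intro continuous_intros conv_half_continuous cont_loc_intD)
  then show "continuous_on {0<..} (conv f g)"
    by (rule continuous_on_eq)
       (use conv_half_split[OF assms] in \<open>auto simp: has_bochner_integral_iff conv_zext\<close>)
  show "loc_int (conv f g)" using assms by (intro loc_int_conv cont_loc_intD)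
qed

text \<open>For continuous factors the integral converges at every point, and the right-hand side
  again has the form \<open>ennreal \<bar>zext _\<bar>\<close>, so the rewriting can be
  iterated.\<close>

lemma nconv_abs:
  assumes "cont_loc_int f" "cont_loc_int g"
  shows "nconv (\<lambda>t. ennreal \<bar>zext f t\<bar>) (\<lambda>t. ennreal \<bar>zext g t\<bar>)
       = (\<lambda>x. ennreal \<bar>zext (conv (\<lambda>t. \<bar>f t\<bar>) (\<lambda>t. \<bar>g t\<bar>)) x\<bar>)"
proof
  fix x
  have int: "integrable lborel (\<lambda>t. \<bar>zext f (x - t)\<bar> * \<bar>zext g t\<bar>)"
    using cont_loc_int_integrable[OF assms[THEN cont_loc_int_abs]] by (simp add: zext_abs)
  have "nconv (\<lambda>t. ennreal \<bar>zext f t\<bar>) (\<lambda>t. ennreal \<bar>zext g t\<bar>) x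
      = (\<integral>\<^sup>+t. ennreal (\<bar>zext f (x - t)\<bar> * \<bar>zext g t\<bar>) \<partial>lborel)"
    by (simp add: nconv_def ennreal_mult)
  also have "\<dots> = ennreal (conv (\<lambda>t. \<bar>f t\<bar>) (\<lambda>t. \<bar>g t\<bar>) x)"
    using int by (subst nn_integral_eq_integral) (auto simp: conv_zext zext_abs)
  also have "\<dots> = ennreal \<bar>zext (conv (\<lambda>t. \<bar>f t\<bar>) (\<lambda>t. \<bar>g t\<bar>)) x\<bar>"
    by (simp add: conv_zext zext_abs integral_nonneg_AE)
  finally show "nconv (\<lambda>t. ennreal \<bar>zext f t\<bar>) (\<lambda>t. ennreal \<bar>zext g t\<bar>) x
      = ennreal \<bar>zext (conv (\<lambda>t. \<bar>f t\<bar>) (\<lambda>t. \<bar>g t\<bar>)) x\<bar>" .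
qed

lemma conv_assoc:
  assumes "cont_loc_int f" "cont_loc_int g" "cont_loc_int h"
  shows "conv f (conv g h) = conv (conv f g) h"
proof
  fix x
  have [measurable]: "zext f \<in> borel_measurable borel" "zext g \<in> borel_measurable borel"
    "zext h \<in> borel_measurable borel"
    using assms by (auto dest: cont_loc_intD loc_int_measurable)
  show "conv f (conv g h) x = conv (conv f g) h x"
  proof (rule conv_assoc_at)
    show "nconv (\<lambda>t. ennreal \<bar>zext f t\<bar>)
        (nconv (\<lambda>t. ennreal \<bar>zext g t\<bar>) (\<lambda>t. ennreal \<bar>zext h t\<bar>)) x < \<infinity>"
      \<comment> \<open>Keeping \<open>zext\<close> around the inner convolution preserves the shape
        that the second use of \<open>nconv_abs\<close> has to match.\<close>
      using assms by (simp add: nconv_abs cont_loc_int_conv cont_loc_int_abs del: zext_conv)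
  qed measurable
qed

section \<open>Linearity and closure properties\<close>

lemma conv_diff_right:
  assumes "cont_loc_int f" "cont_loc_int g" "cont_loc_int h"
  shows "conv f (\<lambda>t. g t - h t) x = conv f g x - conv f h x"
proof -
  have "conv f (\<lambda>t. g t - h t) x = (\<integral>t. zext f (x - t) * zext g t - zext f (x - t) * zext h t \<partial>lborel)"
    unfolding conv_zext by (intro Bochner_Integration.integral_cong) (auto simp: zext_def algebra_simps)
  also have "\<dots> = conv f g x - conv f h x"
    unfolding conv_zext by (intro Bochner_Integration.integral_diff cont_loc_int_integrable assms)
  finally show ?thesis .
qed

lemma conv_add_right:
  assumes "cont_loc_int f" "cont_loc_int g" "cont_loc_int h"
  shows "conv f (\<lambda>t. g t + h t) x = conv f g x + conv f h x"
proof -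
  have "conv f (\<lambda>t. g t + h t) x = (\<integral>t. zext f (x - t) * zext g t + zext f (x - t) * zext h t \<partial>lborel)"
    unfolding conv_zext by (intro Bochner_Integration.integral_cong) (auto simp: zext_def algebra_simps)
  also have "\<dots> = conv f g x + conv f h x"
    unfolding conv_zext by (intro Bochner_Integration.integral_add cont_loc_int_integrable assms)
  finally show ?thesis .
qed

lemma conv_cmult_right: "conv f (\<lambda>t. c * g t) x = c * conv f g x"
  by (simp add: conv_def algebra_simps flip: set_integral_mult_right)

lemma cont_loc_int_diff: "cont_loc_int f \<Longrightarrow> cont_loc_int g \<Longrightarrow> cont_loc_int (\<lambda>t. f t - g t)"
  and cont_loc_int_add: "cont_loc_int f \<Longrightarrow> cont_loc_int g \<Longrightarrow> cont_loc_int (\<lambda>t. f t + g t)"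
  and cont_loc_int_cmult: "cont_loc_int f \<Longrightarrow> cont_loc_int (\<lambda>t. c * f t)"
  by (auto simp: cont_loc_int_def loc_int_def intro!: continuous_intros)

lemma loc_int_cong: "(\<And>t. t > 0 \<Longrightarrow> f t = g t) \<Longrightarrow> loc_int f \<longleftrightarrow> loc_int g"
  unfolding loc_int_def by (intro all_cong1 set_integrable_cong) auto

lemma cont_loc_int_cong: "(\<And>t. t > 0 \<Longrightarrow> f t = g t) \<Longrightarrow> cont_loc_int f \<longleftrightarrow> cont_loc_int g"
  unfolding cont_loc_int_def by (intro conj_cong loc_int_cong continuous_on_cong) auto

text \<open>On a bounded interval \<open>f1\<close> is bounded, and the power is integrable at 0
  because its exponent exceeds -1.\<close>

lemma cont_loc_int_powr_mult:
  assumes "q > -1" and f1: "continuous_on {0..} f1"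
  shows "cont_loc_int (\<lambda>x. x powr q * f1 x)"
  unfolding cont_loc_int_def
proof
  show cont: "continuous_on {0<..} (\<lambda>x. x powr q * f1 x)"
    by (intro continuous_intros continuous_on_subset[OF f1]) auto
  show "loc_int (\<lambda>x. x powr q * f1 x)"
    unfolding loc_int_def
  proof
    fix X
    show "set_integrable lborel {0<..<X} (\<lambda>x. x powr q * f1 x)"
    proof (cases "X > 0")
      case True
      have "bounded (f1 ` {0..X})"
        by (intro compact_imp_bounded compact_continuous_image continuous_on_subset[OF f1]) auto
      then obtain M where M: "\<And>y. y \<in> {0..X} \<Longrightarrow> \<bar>f1 y\<bar> \<le> M"
        by (force simp: bounded_iff)
      have "(\<lambda>x. x powr q) absolutely_integrable_on {0..X}"
        using integrable_on_powr_from_0[OF assms(1), of X] True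
        by (subst absolutely_integrable_on_iff_nonneg) auto
      then have "set_integrable lborel {0..X} (\<lambda>x. x powr q)"
        by (simp add: set_integrable_def integrable_completion)
      then have "set_integrable lborel {0<..<X} (\<lambda>x. M * x powr q)"
        by (intro set_integrable_mult_right) (auto intro: set_integrable_subset)
      then show ?thesis
      proof (rule set_integrable_bound)
        have "continuous_on {0<..<X} (\<lambda>x. x powr q * f1 x)"
          by (rule continuous_on_subset[OF cont]) auto
        then show "set_borel_measurable lborel {0<..<X} (\<lambda>x. x powr q * f1 x)"
          unfolding set_borel_measurable_def
          using borel_measurable_continuous_on_indicator[of "{0<..<X}" "\<lambda>x. x powr q * f1 x"] by simp
        show "AE x in lborel. x \<in> {0<..<X} \<longrightarrow> norm (x powr q * f1 x) \<le> norm (M * x powr q)"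
        proof (intro AE_I2 impI)
          fix x assume "x \<in> {0<..<X}"
          then have "\<bar>f1 x\<bar> * x powr q \<le> \<bar>M\<bar> * x powr q"
            using M[of x] by (intro mult_right_mono) auto
          then show "norm (x powr q * f1 x) \<le> norm (M * x powr q)" by (simp add: abs_mult mult.commute)
        qed
      qed
    qed simp
  qed
qed

lemma cont_loc_int_const: "cont_loc_int (\<lambda>_. c)"
  using cont_loc_int_powr_mult[of 0 "\<lambda>_. c"]
    cont_loc_int_cong[of "\<lambda>x. x powr 0 * c" "\<lambda>_. c"] by auto

lemma C_minus1_cont_loc_int: "f \<in> C_minus1 \<Longrightarrow> cont_loc_int f"
  unfolding C_minus1_def
proof clarify
  fix q f1 assume "(-1::real) < q" "continuous_on {0..} f1" "\<forall>x>0. f x = x powr q * f1 x"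
  then show "cont_loc_int f"
    using cont_loc_int_powr_mult[of q f1] cont_loc_int_cong[of f "\<lambda>x. x powr q * f1 x"] by simp
qed

lemma C_minus1_0_cont_loc_int: "f \<in> C_minus1_0 \<Longrightarrow> cont_loc_int f"
  unfolding C_minus1_0_def
proof clarify
  fix p f1 assume "(0::real) < p" "continuous_on {0..} f1" "\<forall>x>0. f x = x powr (p - 1) * f1 x"
  then show "cont_loc_int f"
    using cont_loc_int_powr_mult[of "p - 1" f1]
      cont_loc_int_cong[of f "\<lambda>x. x powr (p - 1) * f1 x"] by simp
qed

section \<open>Fractional integrals and derivatives\<close>

lemma conv_one: "conv (\<lambda>_. 1) h x = (LBINT t:{0<..<x}. h t)"
  by (simp add: conv_def)

text \<open>The fundamental theorem on \<open>{a..x}\<close>, with \<open>a\<close> tending to 0;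
  integrability of the derivative up to 0 makes the limit exist.\<close>

lemma deriv_loc_int_tendsto:
  assumes diff: "\<And>x. x > 0 \<Longrightarrow> g differentiable (at x)" and int: "loc_int (deriv g)" and "x > 0"
  shows "(g \<longlongrightarrow> g x - conv (\<lambda>_. 1) (deriv g) x) (at_right 0)"
proof -
  have int_x: "set_integrable lborel {0<..x} (deriv g)"
    by (rule set_integrable_subset[of _ "{0<..<x + 1}"]) (use int in \<open>auto simp: loc_int_def\<close>)
  have "(LBINT t:{0<..x}. deriv g t) = (LBINT t:{0<..<x}. deriv g t)"
    by (rule set_integral_discrete_difference[where X = "{x}"]) auto
  with tendsto_set_lebesgue_integral_at_right[OF \<open>x > 0\<close> _ int_x]
  have "((\<lambda>a. g x - (LBINT t:{a..x}. deriv g t)) \<longlongrightarrow> g x - conv (\<lambda>_. 1) (deriv g) x) (at_right 0)"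
    by (auto simp: conv_one intro: tendsto_intros)
  moreover have "\<forall>\<^sub>F a in at_right 0. g x - (LBINT t:{a..x}. deriv g t) = g a"
    using eventually_at_right_less[of 0] eventually_at_right_real[OF \<open>x > 0\<close>]
  proof eventually_elim
    case (elim a)
    \<comment> \<open>The gauge integral recovers \<open>g\<close> from a derivative that may be
      discontinuous; it agrees with the Lebesgue integral because \<open>deriv g\<close> is Lebesgue
      integrable here.\<close>
    have "(deriv g has_integral g x - g a) {a..x}"
    proof (rule fundamental_theorem_of_calculus)
      fix t assume "t \<in> {a..x}"
      then have "(g has_field_derivative deriv g t) (at t)"
        using diff[of t] elim by (auto simp: DERIV_deriv_iff_real_differentiable)
      then show "(g has_vector_derivative deriv g t) (at t within {a..x})"
        by (auto simp: has_real_derivative_iff_has_vector_derivative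
            intro: has_vector_derivative_at_within)
    qed (use elim in auto)
    moreover have "set_integrable lborel {a..x} (deriv g)"
      by (rule set_integrable_subset[OF int_x]) (use elim in auto)
    ultimately show ?case
      using set_borel_integral_eq_integral(2)[of "{a..x}" "deriv g"] by (simp add: integral_unique)
  qed
  ultimately show ?thesis by (rule Lim_transform_eventually)
qed

text \<open>The limit behind \<open>val0 g\<close> exists, so \<open>Lim\<close> returns its true
  value.\<close>

lemma conv_one_deriv:
  assumes "\<And>x. x > 0 \<Longrightarrow> g differentiable (at x)" "loc_int (deriv g)" "x > 0"
  shows "conv (\<lambda>_. 1) (deriv g) x = g x - val0 g"
  using tendsto_Lim[OF _ deriv_loc_int_tendsto[OF assms]] by (simp add: val0_def)

lemma cont_loc_int_of_deriv:
  assumes diff: "\<And>x. x > 0 \<Longrightarrow> g differentiable (at x)" and int: "loc_int (deriv g)"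
  shows "cont_loc_int g"
  unfolding cont_loc_int_def
proof
  show "continuous_on {0<..} g"
    by (intro continuous_at_imp_continuous_on ballI)
       (use diff in \<open>auto intro: differentiable_imp_continuous_within\<close>)
  have "loc_int (\<lambda>t. conv (\<lambda>_. 1) (deriv g) t + val0 g)"
    using loc_int_conv[OF cont_loc_intD(2)[OF cont_loc_int_const] int]
      cont_loc_intD(2)[OF cont_loc_int_const]
    unfolding loc_int_def by (auto intro!: set_integral_add(1))
  then show "loc_int g"
    using loc_int_cong[of g "\<lambda>t. conv (\<lambda>_. 1) (deriv g) t + val0 g"]
      conv_one_deriv[OF diff int] by simp
qed

text \<open>Splitting off the constant integral over \<open>{0<..<a}\<close> with
  \<open>a = x / 2\<close> leaves an integral over an interval away from 0, where \<open>h\<close>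
  is continuous.\<close>

lemma conv_one_has_derivative:
  assumes h: "cont_loc_int h" and "x > 0"
  shows "(conv (\<lambda>_. 1) h has_real_derivative h x) (at x)"
proof -
  define a where "a = x / 2"
  have a: "0 < a" "a < x" using \<open>x > 0\<close> by (auto simp: a_def)
  have "continuous_on {a..x + 1} h"
    by (rule continuous_on_subset[OF cont_loc_intD(1)[OF h]]) (use a in auto)
  then have "((\<lambda>y. integral {a..y} h) has_real_derivative h x) (at x within {a..x + 1})"
    using a by (intro integral_has_real_derivative) auto
  moreover have "x \<in> interior {a..x + 1}" using a by simp
  ultimately have "((\<lambda>y. integral {a..y} h) has_real_derivative h x) (at x)"
    by (metis at_within_interior)
  then have "((\<lambda>y. conv (\<lambda>_. 1) h a + integral {a..y} h) has_real_derivative h x) (at x)"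
    by (auto intro!: derivative_eq_intros)
  moreover have "conv (\<lambda>_. 1) h a + integral {a..y} h = conv (\<lambda>_. 1) h y" if "y > a" for y
  proof -
    have int: "set_integrable lborel {0<..y} h"
      by (rule set_integrable_subset[of _ "{0<..<y + 1}"])
         (use cont_loc_intD(2)[OF h] in \<open>auto simp: loc_int_def\<close>)
    have "conv (\<lambda>_. 1) h y = (LBINT t:{0<..y}. h t)"
      unfolding conv_one by (rule set_integral_discrete_difference[where X = "{y}"]) auto
    also have "{0<..y} = {0<..<a} \<union> {a..y}" using a that by auto
    also have "(LBINT t:{0<..<a} \<union> {a..y}. h t) = (LBINT t:{0<..<a}. h t) + (LBINT t:{a..y}. h t)"
      by (rule set_integral_Un) (use a that in \<open>auto intro: set_integrable_subset[OF int]\<close>)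
    also have "(LBINT t:{a..y}. h t) = integral {a..y} h"
      by (rule set_borel_integral_eq_integral) (use a that in \<open>auto intro: set_integrable_subset[OF int]\<close>)
    finally show ?thesis by (simp add: conv_one)
  qed
  then have "\<forall>\<^sub>F y in nhds x. conv (\<lambda>_. 1) h a + integral {a..y} h = conv (\<lambda>_. 1) h y"
    using eventually_nhds_in_open[of "{a<..}" x] a by (auto elim: eventually_mono)
  ultimately show ?thesis
    by (simp add: DERIV_cong_ev[OF refl _ refl])
qed

text \<open>Near \<open>x0\<close> the kernel stays away from 0. At the point \<open>x0 + u\<close>
  this part of the kernel meets the values of \<open>h\<close> near \<open>u\<close>, so convergence
  there makes \<open>h\<close> integrable near \<open>u\<close>, including
  \<open>u = 0\<close>.\<close>

lemma loc_int_of_conv_exists: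
  assumes k: "cont_loc_int k" and "x0 > 0" "k x0 \<noteq> 0" and ex: "conv_exists k h"
  shows "loc_int h"
proof -
  define c where "c = \<bar>k x0\<bar> / 2"
  have "c > 0" using assms by (simp add: c_def)
  have [measurable]: "zext k \<in> borel_measurable borel"
    using k by (auto dest: cont_loc_intD loc_int_measurable)
  have "isCont k x0"
    using cont_loc_intD(1)[OF k] \<open>x0 > 0\<close> by (simp add: continuous_on_eq_continuous_at)
  then obtain e where "e > 0" and e: "\<And>y. \<bar>y - x0\<bar> < e \<Longrightarrow> \<bar>k y - k x0\<bar> < c"
    using \<open>c > 0\<close> unfolding continuous_at_eps_delta dist_real_def by metis
  \<comment> \<open>The bound \<open>d \<le> x0\<close> keeps the window around \<open>u\<close>
    below \<open>x0 + u\<close>, so that it lies inside the domain of integration.\<close>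
  define d where "d = min e x0"
  have d: "d > 0" "d \<le> x0" "d \<le> e" using \<open>e > 0\<close> \<open>x0 > 0\<close> by (auto simp: d_def)
  have kc: "\<bar>k y\<bar> > c" if "\<bar>y - x0\<bar> < d" for y
    using e[of y] that d abs_triangle_ineq2[of "k x0" "k x0 - k y"] unfolding c_def by linarith
  have local: "set_integrable lborel ({0<..} \<inter> {u - d<..<u + d}) h" if "u \<ge> 0" for u
  proof -
    define S where "S = {0<..} \<inter> {u - d<..<u + d}"
    define x where "x = x0 + u"
    have "x > 0" using that \<open>x0 > 0\<close> by (simp add: x_def)
    then have "set_integrable lborel {0<..<x} (\<lambda>t. k (x - t) * h t)"
      using ex by (simp add: conv_exists_def)
    then have "set_integrable lborel S (\<lambda>t. k (x - t) * h t)"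
      by (rule set_integrable_subset) (use d in \<open>auto simp: S_def x_def\<close>)
    then have int: "integrable lborel (\<lambda>t. indicator S t * (k (x - t) * h t))"
      by (simp add: set_integrable_def)
    then have [measurable]: "(\<lambda>t. indicator S t * (k (x - t) * h t)) \<in> borel_measurable borel"
      by (auto dest: borel_measurable_integrable)
    have big: "\<bar>k (x - t)\<bar> > c" "zext k (x - t) = k (x - t)" if "t \<in> S" for t
    proof -
      have "\<bar>x - t - x0\<bar> < d" using that d by (auto simp: S_def x_def)
      then show "\<bar>k (x - t)\<bar> > c" by (rule kc)
      show "zext k (x - t) = k (x - t)" using that d by (auto simp: S_def x_def)
    qed
    \<comment> \<open>Measurability of \<open>h\<close> on \<open>S\<close> is not given; it is
      recovered by dividing the measurable product by the measurable kernel.\<close>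
    have eq: "indicator S t * h t = indicator S t * (k (x - t) * h t) / zext k (x - t)" for t
      using big[of t] \<open>c > 0\<close> by (auto simp: indicator_def)
    have "integrable lborel (\<lambda>t. indicator S t * h t)"
    proof (rule Bochner_Integration.integrable_bound)
      show "integrable lborel (\<lambda>t. 1 / c * (indicator S t * (k (x - t) * h t)))"
        using int by (rule integrable_mult_right)
      show "(\<lambda>t. indicator S t * h t) \<in> borel_measurable lborel"
        unfolding eq by measurable
      show "AE t in lborel. norm (indicator S t * h t)
          \<le> norm (1 / c * (indicator S t * (k (x - t) * h t)))"
      proof (intro AE_I2)
        fix t
        show "norm (indicator S t * h t) \<le> norm (1 / c * (indicator S t * (k (x - t) * h t)))"
        proof (cases "t \<in> S")
          case True
          have "c * \<bar>h t\<bar> \<le> \<bar>k (x - t)\<bar> * \<bar>h t\<bar>"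
            using big(1)[OF True] by (intro mult_right_mono) auto
          with True \<open>c > 0\<close> show ?thesis by (simp add: abs_mult field_simps)
        qed simp
      qed
    qed
    then show ?thesis by (simp add: set_integrable_def S_def)
  qed
  \<comment> \<open>Windows of radius \<open>d\<close> centred at the multiples of \<open>d\<close>
    overlap, and each of them extends the covered interval by \<open>d\<close>.\<close>
  have *: "set_integrable lborel {0<..<real m * d} h" for m
  proof (induction m)
    case (Suc m)
    have "set_integrable lborel ({0<..<real m * d} \<union> ({0<..} \<inter> {real m * d - d<..<real m * d + d})) h"
      using Suc local[of "real m * d"] d by (intro set_integrable_Un) auto
    then show ?case
      by (rule set_integrable_subset) (auto simp: algebra_simps)
  qed simp
  show ?thesis
    unfolding loc_int_def
  proof
    fix X
    obtain m :: nat where "X < real m * d" using reals_Archimedean3[OF d(1)] by blast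
    then show "set_integrable lborel {0<..<X} h"
      by (intro set_integrable_subset[OF *[of m]]) auto
  qed
qed

lemma gfi_caputo_AE:
  assumes \<kappa>: "cont_loc_int \<kappa>" and k: "cont_loc_int k" and one: "\<And>x. x > 0 \<Longrightarrow> conv \<kappa> k x = 1"
    and diff: "\<And>x. x > 0 \<Longrightarrow> g differentiable (at x)" and int: "loc_int (deriv g)"
  shows "AE x in lborel. x > 0 \<longrightarrow> gfi \<kappa> (caputo_gfd k g) x = g x - val0 g"
proof -
  have eq: "conv (conv \<kappa> k) (deriv g) = conv (\<lambda>_. 1) (deriv g)"
    by (rule conv_cong) (use one in auto)
  show ?thesis
    using conv_assoc_AE[OF cont_loc_intD(2)[OF \<kappa>] cont_loc_intD(2)[OF k] int]
    by eventually_elim (simp add: eq gfi_def caputo_gfd_def conv_one_deriv[OF diff int])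
qed

text \<open>The pointwise version serves \<open>n = 1\<close>, where no outer integral remains to
  absorb a null set.\<close>

lemma gfi_caputo:
  assumes \<kappa>: "cont_loc_int \<kappa>" and k: "cont_loc_int k" and one: "\<And>x. x > 0 \<Longrightarrow> conv \<kappa> k x = 1"
    and diff: "\<And>x. x > 0 \<Longrightarrow> g differentiable (at x)" and int: "cont_loc_int (deriv g)"
    and "x > 0"
  shows "gfi \<kappa> (caputo_gfd k g) x = g x - val0 g"
proof -
  have "conv (conv \<kappa> k) (deriv g) = conv (\<lambda>_. 1) (deriv g)"
    by (rule conv_cong) (use one in auto)
  then show ?thesis
    using conv_assoc[OF \<kappa> k int] conv_one_deriv[OF diff cont_loc_intD(2)[OF int] \<open>x > 0\<close>]
    by (simp add: gfi_def caputo_gfd_def)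
qed

section \<open>Iterated integrals and convolution powers\<close>

text \<open>As \<open>n \<ge> 1\<close>, the innermost integral already removes the difference on a
  null set.\<close>

lemma gfi_iter_cong_AE:
  assumes "AE t in lborel. t > 0 \<longrightarrow> u t = v t" "n \<ge> 1"
    and "loc_int \<kappa>" "zext u \<in> borel_measurable borel" "zext v \<in> borel_measurable borel"
  shows "(gfi \<kappa> ^^ n) u = (gfi \<kappa> ^^ n) v"
proof -
  obtain m where "n = Suc m" using \<open>n \<ge> 1\<close> by (cases n) auto
  moreover have "gfi \<kappa> u = gfi \<kappa> v"
    unfolding gfi_def using assms by (intro conv_cong_AE) (auto dest: loc_int_measurable)
  ultimately show ?thesis by (simp add: funpow_Suc_right del: funpow.simps)
qed

lemma gfi_iter_cont_loc_int:
  assumes "cont_loc_int \<kappa>" "cont_loc_int u"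
  shows "cont_loc_int ((gfi \<kappa> ^^ n) u)"
  by (induction n) (use assms in \<open>auto simp: gfi_def intro: cont_loc_int_conv\<close>)

lemma gfi_iter_diff:
  assumes "cont_loc_int \<kappa>" "cont_loc_int u" "cont_loc_int v"
  shows "(gfi \<kappa> ^^ n) (\<lambda>t. u t - c * v t) = (\<lambda>t. (gfi \<kappa> ^^ n) u t - c * (gfi \<kappa> ^^ n) v t)"
proof (induction n)
  case (Suc n)
  show ?case
    by (simp add: Suc gfi_def[of \<kappa> "\<lambda>t. (gfi \<kappa> ^^ n) u t - c * (gfi \<kappa> ^^ n) v t"]
        gfi_def[of \<kappa> "(gfi \<kappa> ^^ n) u"] gfi_def[of \<kappa> "(gfi \<kappa> ^^ n) v"] fun_eq_iff
        conv_diff_right conv_cmult_right cont_loc_int_cmult gfi_iter_cont_loc_int assms)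
qed simp

lemma conv_pow_Suc: "n \<ge> 1 \<Longrightarrow> conv_pow g (Suc n) = conv g (conv_pow g n)"
  by (cases n) (auto simp: conv_pow_def)

lemma conv_pow_1 [simp]: "conv_pow g (Suc 0) = g"
  by (simp add: conv_pow_def)

lemma cont_loc_int_conv_pow: "cont_loc_int g \<Longrightarrow> cont_loc_int (conv_pow g n)"
proof -
  assume g: "cont_loc_int g"
  have "cont_loc_int ((conv g ^^ m) g)" for m
    by (induction m) (auto intro: cont_loc_int_conv g)
  then show ?thesis by (simp add: conv_pow_def)
qed

text \<open>Associativity and commutativity move the constant 1 to the front at every step; this
  produces the coefficient functions of the final sum.\<close>

lemma gfi_iter_one:
  assumes "cont_loc_int \<kappa>" "n \<ge> 1"
  shows "(gfi \<kappa> ^^ n) (\<lambda>_. 1) = conv (\<lambda>_. 1) (conv_pow \<kappa> n)"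
  using \<open>n \<ge> 1\<close>
proof (induction n rule: nat_induct_at_least)
  case base
  show ?case by (simp add: gfi_def conv_commute)
next
  case (Suc n)
  have "(gfi \<kappa> ^^ Suc n) (\<lambda>_. 1) = conv \<kappa> (conv (\<lambda>_. 1) (conv_pow \<kappa> n))"
    by (simp add: Suc.IH) (simp add: gfi_def)
  also have "\<dots> = conv (conv (\<lambda>_. 1) \<kappa>) (conv_pow \<kappa> n)"
    by (simp add: conv_assoc cont_loc_int_const cont_loc_int_conv_pow assms conv_commute[of \<kappa> "\<lambda>_. 1"])
  also have "\<dots> = conv (\<lambda>_. 1) (conv_pow \<kappa> (Suc n))"
    using Suc.hyps by (simp add: conv_assoc cont_loc_int_const cont_loc_int_conv_pow assms conv_pow_Suc)
  finally show ?case .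
qed

section \<open>Regularity of the sequential derivatives\<close>

text \<open>A weakening of \<open>C_minus1_n\<close> that keeps only continuity and local
  integrability of the top derivative.\<close>

definition cont_deriv :: "nat \<Rightarrow> (real \<Rightarrow> real) \<Rightarrow> bool" where
  "cont_deriv n f \<longleftrightarrow> (\<forall>m<n. \<forall>x>0. (deriv ^^ m) f differentiable (at x))
      \<and> cont_loc_int ((deriv ^^ n) f)"

text \<open>Going down one order is an integration: a function with locally integrable derivative is
  itself continuous and locally integrable.\<close>

lemma cont_deriv_mono:
  assumes "cont_deriv n f" "m \<le> n"
  shows "cont_deriv m f"
  using assms(2,1)
proof (induction rule: inc_induct)
  case (step i)
  then have "cont_deriv (Suc i) f" by simp
  then have "\<And>x. x > 0 \<Longrightarrow> (deriv ^^ i) f differentiable (at x)" "loc_int (deriv ((deriv ^^ i) f))"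
    by (auto simp: cont_deriv_def dest: cont_loc_intD)
  then have "cont_loc_int ((deriv ^^ i) f)" by (rule cont_loc_int_of_deriv)
  with \<open>cont_deriv (Suc i) f\<close> show ?case by (auto simp: cont_deriv_def)
qed

text \<open>With \<open>c = val0 (deriv f)\<close> one has f' = c + 1 * f'', hence k * f' = 1 * (c k
  + k * f''), and differentiation removes the convolution with 1.\<close>

lemma caputo_deriv:
  assumes k: "cont_loc_int k" and f: "cont_deriv 2 f" and "x > 0"
  shows "(caputo_gfd k f has_real_derivative
           val0 (deriv f) * k x + conv k (deriv (deriv f)) x) (at x)"
proof -
  let ?c = "val0 (deriv f)" and ?h = "deriv (deriv f)"
  have diff: "\<And>x. x > 0 \<Longrightarrow> deriv f differentiable (at x)" and h: "cont_loc_int ?h"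
    using f by (auto simp: cont_deriv_def numeral_2_eq_2 dest: spec[of _ 1])
  have one: "cont_loc_int (\<lambda>_. 1)" by (rule cont_loc_int_const)
  note W = cont_loc_int_add cont_loc_int_cmult cont_loc_int_conv
  have "caputo_gfd k f = conv k (\<lambda>t. ?c * 1 + conv (\<lambda>_. 1) ?h t)"
    unfolding caputo_gfd_def
    by (rule conv_cong) (use conv_one_deriv[OF diff cont_loc_intD(2)[OF h]] in auto)
  also have "\<dots> = (\<lambda>x. ?c * conv k (\<lambda>_. 1) x + conv k (conv (\<lambda>_. 1) ?h) x)"
    by (rule ext, subst conv_add_right, rule k, intro W one, intro W one h)
       (simp only: conv_cmult_right)
  also have "conv k (conv (\<lambda>_. 1) ?h) = conv (\<lambda>_. 1) (conv k ?h)"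
    by (simp add: conv_assoc k h one conv_commute[of k "\<lambda>_. 1"])
  also have "conv k (\<lambda>_. 1) = conv (\<lambda>_. 1) k" by (rule conv_commute)
  also have "(\<lambda>x. ?c * conv (\<lambda>_. 1) k x + conv (\<lambda>_. 1) (conv k ?h) x)
      = conv (\<lambda>_. 1) (\<lambda>t. ?c * k t + conv k ?h t)"
    by (rule ext, subst conv_add_right, rule one, intro W k, intro W k h)
       (simp only: conv_cmult_right)
  finally show ?thesis
    using conv_one_has_derivative[of "\<lambda>t. ?c * k t + conv k ?h t" x] \<open>x > 0\<close> k h by (simp add: W)
qed

text \<open>Three sources: smoothness of \<open>f\<close> for \<open>n = 0\<close>, the explicit
  derivative for \<open>n = 1\<close>, and for \<open>n \<ge> 2\<close> the existence of the next
  sequential derivative, which forces local integrability.\<close>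

lemma caputo_iter_deriv:
  assumes k: "cont_loc_int k" and x0: "x0 > 0" "k x0 \<noteq> 0"
    and f: "cont_deriv (Suc n) f" and ex: "seq_caputo_gfd_exists k (Suc n) f"
  shows "\<And>x. x > 0 \<Longrightarrow> (caputo_gfd k ^^ n) f differentiable (at x)"
    and "loc_int (deriv ((caputo_gfd k ^^ n) f))"
proof -
  consider "n = 0" | "n = 1" | "n \<ge> 2" by linarith
  then have "(\<forall>x>0. (caputo_gfd k ^^ n) f differentiable (at x))
      \<and> loc_int (deriv ((caputo_gfd k ^^ n) f))"
  proof cases
    case 1
    with f show ?thesis by (auto simp: cont_deriv_def dest: cont_loc_intD)
  next
    case 2
    let ?d = "\<lambda>x. val0 (deriv f) * k x + conv k (deriv (deriv f)) x"
    have f2: "cont_deriv 2 f" using f 2 by (simp add: numeral_2_eq_2)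
    then have "cont_loc_int (deriv (deriv f))" by (auto simp: cont_deriv_def numeral_2_eq_2)
    then have "cont_loc_int ?d"
      by (intro cont_loc_int_add cont_loc_int_cmult cont_loc_int_conv k)
    moreover have "deriv (caputo_gfd k f) x = ?d x" if "x > 0" for x
      using caputo_deriv[OF k f2 that] by (rule DERIV_imp_deriv)
    ultimately have "loc_int (deriv (caputo_gfd k f))"
      using loc_int_cong[of "deriv (caputo_gfd k f)" ?d] by (auto dest: cont_loc_intD)
    then show ?thesis
      using 2 caputo_deriv[OF k f2] by (auto simp: real_differentiable_def)
  next
    case 3
    then have "caputo_gfd_exists k ((caputo_gfd k ^^ n) f)"
      using ex by (auto simp: seq_caputo_gfd_exists_def)
    then show ?thesis
      using loc_int_of_conv_exists[OF k x0] by (auto simp: caputo_gfd_exists_def)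
  qed
  then show "\<And>x. x > 0 \<Longrightarrow> (caputo_gfd k ^^ n) f differentiable (at x)"
    and "loc_int (deriv ((caputo_gfd k ^^ n) f))" by auto
qed

theorem theorem4p5:
  fixes \<kappa> k f :: "real \<Rightarrow> real" and n :: nat and x :: real
  assumes "(\<kappa>, k) \<in> sonine_L1"
    and "n \<ge> 1"
    and "f \<in> C_minus1_n n"
    and "seq_caputo_gfd_exists k n f"
    and "x > 0"
  shows "(gfi \<kappa> ^^ n) ((caputo_gfd k ^^ n) f) x
       = f x - val0 f
         - (\<Sum>j=1..n - 1. val0 ((caputo_gfd k ^^ j) f) * conv (\<lambda>_. 1) (conv_pow \<kappa> j) x)"
proof -
  have \<kappa>: "cont_loc_int \<kappa>" and k: "cont_loc_int k" and one: "\<And>x. x > 0 \<Longrightarrow> conv \<kappa> k x = 1"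
    using assms(1) by (auto simp: sonine_L1_def intro: C_minus1_0_cont_loc_int)
  \<comment> \<open>A kernel vanishing on the whole positive half-line would give convolution 0 with
    \<open>\<kappa>\<close> instead of 1.\<close>
  obtain x0 where x0: "x0 > 0" "k x0 \<noteq> 0"
  proof (rule ccontr)
    assume "\<not> thesis"
    then have "conv \<kappa> k = conv \<kappa> (\<lambda>_. 0)" using that by (intro conv_cong) auto
    with one[of 1] show False by (simp add: conv_def)
  qed
  \<comment> \<open>The induction runs on this weaker condition, which passes from
    \<open>Suc n\<close> to \<open>n\<close> by \<open>cont_deriv_mono\<close>.\<close>
  have "cont_deriv n f"
    using assms(3) C_minus1_cont_loc_int by (auto simp: C_minus1_n_def cont_deriv_def)
  with \<open>n \<ge> 1\<close> \<open>seq_caputo_gfd_exists k n f\<close> \<open>x > 0\<close> show ?thesis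
  proof (induction n arbitrary: x rule: nat_induct_at_least)
    case base
    then show ?case
      using gfi_caputo[OF \<kappa> k one, of f x] by (auto simp: cont_deriv_def)
  next
    case (Suc n)
    let ?g = "(caputo_gfd k ^^ n) f"
    have diff: "\<And>x. x > 0 \<Longrightarrow> ?g differentiable (at x)" and int: "loc_int (deriv ?g)"
      using caputo_iter_deriv[OF k x0 Suc.prems(3,1)] by auto
    have g: "cont_loc_int ?g" by (rule cont_loc_int_of_deriv[OF diff int])
    have "loc_int (gfi \<kappa> (caputo_gfd k ?g))"
      unfolding gfi_def caputo_gfd_def[of _ ?g] by (intro loc_int_conv cont_loc_intD \<kappa> k int)
    \<comment> \<open>The factor 1 stands for the constant function to which
      \<open>gfi_iter_diff\<close> and \<open>gfi_iter_one\<close> are applied below.\<close>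
    moreover have "loc_int (\<lambda>t. ?g t - val0 ?g * 1)"
      by (intro cont_loc_intD(2) cont_loc_int_diff g cont_loc_int_const)
    ultimately have meas: "zext (gfi \<kappa> (caputo_gfd k ?g)) \<in> borel_measurable borel"
      "zext (\<lambda>t. ?g t - val0 ?g * 1) \<in> borel_measurable borel"
      by (auto dest: loc_int_measurable)
    \<comment> \<open>The innermost integral is paired with the outermost derivative; the remaining
      \<open>n \<ge> 1\<close> integrals upgrade their almost-everywhere cancellation to an
      equality.\<close>
    have "(gfi \<kappa> ^^ Suc n) ((caputo_gfd k ^^ Suc n) f) = (gfi \<kappa> ^^ n) (gfi \<kappa> (caputo_gfd k ?g))"
      unfolding funpow_Suc_right[of n "gfi \<kappa>"] by simp
    also have "\<dots> = (gfi \<kappa> ^^ n) (\<lambda>t. ?g t - val0 ?g * 1)"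
      using gfi_caputo_AE[OF \<kappa> k one diff int] Suc.hyps cont_loc_intD(2)[OF \<kappa>] meas
      by (intro gfi_iter_cong_AE) auto
    also have "\<dots> = (\<lambda>x. (gfi \<kappa> ^^ n) ?g x - val0 ?g * conv (\<lambda>_. 1) (conv_pow \<kappa> n) x)"
      using gfi_iter_diff[OF \<kappa> g cont_loc_int_const, of n "val0 ?g" 1] gfi_iter_one[OF \<kappa> Suc.hyps]
      by simp
    finally have "(gfi \<kappa> ^^ Suc n) ((caputo_gfd k ^^ Suc n) f) x
        = (gfi \<kappa> ^^ n) ?g x - val0 ?g * conv (\<lambda>_. 1) (conv_pow \<kappa> n) x"
      by (rule fun_cong)
    also have "(gfi \<kappa> ^^ n) ?g x = f x - val0 f
         - (\<Sum>j=1..n - 1. val0 ((caputo_gfd k ^^ j) f) * conv (\<lambda>_. 1) (conv_pow \<kappa> j) x)"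
    proof (rule Suc.IH)
      show "seq_caputo_gfd_exists k n f"
        using Suc.prems(1) by (simp add: seq_caputo_gfd_exists_def)
      show "cont_deriv n f" by (rule cont_deriv_mono[OF Suc.prems(3)]) simp
    qed (rule Suc.prems(2))
    \<comment> \<open>The sum gains exactly the term \<open>j = n\<close>. As
      \<open>n \<ge> 1\<close>, the truncated subtraction in \<open>n - 1\<close> does no
      harm.\<close>
    finally show ?case
      using Suc.hyps by (cases n) (simp_all add: algebra_simps)
  qed
qed

end
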